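(* Let $\mathcal{G}$ be a finite, connected, simple graph with edge set $\mathcal{E}$, all of whose vertices have degree at least two, regarded as an equilateral quantum graph with every edge identified with $[0,1]$, and let $\mathcal{L}=-d^2/dx^2$ be the Laplacian with Kirchhoff vertex conditions (defined in the context). Let $\omega>0$ and let $m$ be a nonnegative integer. Suppose $z_1$ and $z_2$ are eigenfunctions of $\mathcal{L}$ with common eigenvalue $[\omega+2m\pi]^2$, obtained from eigenfunctions $y_1$ and $y_2$ of $\mathcal{L}$ with common eigenvalue $\omega^2$ by increasing the frequency, that is, $z_j=S_m y_j$ for $j=1,2$, where $S_m$ is the frequency shift defined in the context. If $y_1$ and $y_2$ are orthonormal in $L^2(\mathcal{G})$, then so are $z_1$ and $z_2$.
   Context: Equilateral quantum graph: each edge of $\mathcal{G}$ is given an orientation and identified with the interval $[0,1]$, the endpoints $0,1$ corresponding to the two vertices of the edge. A function $f$ on $\mathcal{G}$ is a collection of components $f_e:[0,1]\to\mathbb{C}$, $e\in\mathcal{E}$. The Hilbert space is $L^2(\mathcal{G})=\bigoplus_{e\in\mathcal{E}}L^2[0,1]$ with inner product $\int_{\mathcal{G}} f\overline{g} = \sum_{e\in\mathcal{E}}\int_0^1 f_e(x)\overline{g_e(x)}\,dx$. The operator $\mathcal{L}$ acts by $\mathcal{L}f=-f''$ on each edge. Its domain consists of the functions that are sufficiently differentiable on each edge (components in the Sobolev space $H^2[0,1]$), continuous on $\mathcal{G}$ (edge components agree at common vertices), and satisfy at each vertex $v$ the Kirchhoff condition: the sum over the edges $e$ incident on $v$ of the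 derivatives of $f_e$ at $v$, taken with respect to local coordinates in which $v$ corresponds to $0$ (i.e. pointing from $v$ into the edge), is zero. $\mathcal{L}$ is self-adjoint on $L^2(\mathcal{G})$. Frequency shift: for $\omega>0$ and a nonnegative integer $m$, $S_m$ sends an eigenfunction $y$ of $\mathcal{L}$ with eigenvalue $\omega^2$, written as $y(x)=A_e\cos(\omega x)+B_e\sin(\omega x)$ on each edge $e\cong[0,1]$, to the function given by $A_e\cos([\omega+2m\pi]x)+B_e\sin([\omega+2m\pi]x)$ on each edge $e$; this is an eigenfunction of $\mathcal{L}$ with eigenvalue $[\omega+2m\pi]^2$. *)

theory Defs
  imports "HOL-Analysis.Analysis" "Graph_Theory.Graph_Theory"
begin

text \<open>
  A finite simple graph is a \<^locale>\<open>pair_graph\<close>: every undirected edge \<open>{u, v}\<close> occurs as the two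
  arcs \<open>(u, v)\<close> and \<open>(v, u)\<close>.  An orientation selects one of them, and the selected arcs serve as
  the edges: \<open>e = (u, v)\<close> is a copy of \<open>[0,1]\<close> with \<open>0\<close> at \<open>u\<close> and \<open>1\<close> at \<open>v\<close>.
\<close>

definition orientation_of :: "'v pair_pre_digraph \<Rightarrow> ('v \<times> 'v) set \<Rightarrow> bool" where
  "orientation_of G E \<longleftrightarrow>
     E \<subseteq> parcs G \<and> (\<forall>u v. (u, v) \<in> parcs G \<longrightarrow> ((u, v) \<in> E \<longleftrightarrow> (v, u) \<notin> E))"

text \<open>
  A function on the quantum graph is given by its components; only the values of \<open>f e\<close> on
  \<open>{0..1}\<close> for edges \<open>e \<in> E\<close> are meaningful.
\<close>

type_synonym 'v qg_fun = "'v \<times> 'v \<Rightarrow> real \<Rightarrow> complex"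

definition qg_eq :: "('v \<times> 'v) set \<Rightarrow> 'v qg_fun \<Rightarrow> 'v qg_fun \<Rightarrow> bool" where
  "qg_eq E f g \<longleftrightarrow> (\<forall>e\<in>E. \<forall>x\<in>{0..1}. f e x = g e x)"

definition qg_ae_eq :: "('v \<times> 'v) set \<Rightarrow> 'v qg_fun \<Rightarrow> 'v qg_fun \<Rightarrow> bool" where
  "qg_ae_eq E f g \<longleftrightarrow> (\<forall>e\<in>E. AE x in lebesgue_on {0..1}. f e x = g e x)"

definition qg_inner :: "('v \<times> 'v) set \<Rightarrow> 'v qg_fun \<Rightarrow> 'v qg_fun \<Rightarrow> complex" where
  "qg_inner E f g = (\<Sum>e\<in>E. LINT x|lebesgue_on {0..1}. f e x * cnj (g e x))"

definition qg_orthonormal :: "('v \<times> 'v) set \<Rightarrow> 'v qg_fun \<Rightarrow> 'v qg_fun \<Rightarrow> bool" where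
  "qg_orthonormal E f g \<longleftrightarrow> qg_inner E f f = 1 \<and> qg_inner E g g = 1 \<and> qg_inner E f g = 0"

definition L2_unit :: "(real \<Rightarrow> complex) set" where
  "L2_unit = {u. u \<in> borel_measurable (lebesgue_on {0..1}) \<and>
                 integrable (lebesgue_on {0..1}) (\<lambda>x. (cmod (u x))\<^sup>2)}"

text \<open>
  Sobolev functions on \<open>[0,1]\<close> are identified with their continuous representatives: \<open>u\<close> has the
  generalised derivative \<open>v \<in> L\<^sup>2[0,1]\<close> iff \<open>u\<close> is absolutely continuous on \<open>[0,1]\<close> with \<open>u' = v\<close>
  almost everywhere.  In \<open>has_L2_deriv2\<close> the first derivative \<open>v\<close> is itself absolutely continuous, so
  \<open>u\<close> is continuously differentiable on \<open>[0,1]\<close>, with one-sided derivatives at the endpoints.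
\<close>

definition has_L2_deriv :: "(real \<Rightarrow> complex) \<Rightarrow> (real \<Rightarrow> complex) \<Rightarrow> bool" where
  "has_L2_deriv u v \<longleftrightarrow>
     v \<in> L2_unit \<and> (\<forall>x\<in>{0..1}. u x = u 0 + (LINT t|lebesgue_on {0..x}. v t))"

definition has_L2_deriv2 :: "(real \<Rightarrow> complex) \<Rightarrow> (real \<Rightarrow> complex) \<Rightarrow> bool" where
  "has_L2_deriv2 u w \<longleftrightarrow> (\<exists>v. has_L2_deriv u v \<and> has_L2_deriv v w)"

definition H2_unit :: "(real \<Rightarrow> complex) set" where
  "H2_unit = {u. \<exists>w. has_L2_deriv2 u w}"

text \<open>The second derivative is determined up to a null set; any representative is chosen.\<close>

definition L2_deriv2 :: "(real \<Rightarrow> complex) \<Rightarrow> real \<Rightarrow> complex" where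
  "L2_deriv2 u = (SOME w. has_L2_deriv2 u w)"

definition incident_edges :: "('v \<times> 'v) set \<Rightarrow> 'v \<Rightarrow> ('v \<times> 'v) set" where
  "incident_edges E v = {e \<in> E. v = fst e \<or> v = snd e}"

text \<open>The component of \<open>f\<close> on an edge incident on \<open>v\<close>, in the local coordinate with \<open>v\<close> at \<open>0\<close>.\<close>

definition local_comp :: "'v qg_fun \<Rightarrow> 'v \<Rightarrow> 'v \<times> 'v \<Rightarrow> real \<Rightarrow> complex" where
  "local_comp f v e = (if v = fst e then f e else (\<lambda>x. f e (1 - x)))"

definition continuous_at_vertex :: "('v \<times> 'v) set \<Rightarrow> 'v qg_fun \<Rightarrow> 'v \<Rightarrow> bool" where
  "continuous_at_vertex E f v \<longleftrightarrow>
     (\<forall>e\<in>incident_edges E v. \<forall>e'\<in>incident_edges E v. local_comp f v e 0 = local_comp f v e' 0)"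

definition kirchhoff_at_vertex :: "('v \<times> 'v) set \<Rightarrow> 'v qg_fun \<Rightarrow> 'v \<Rightarrow> bool" where
  "kirchhoff_at_vertex E f v \<longleftrightarrow>
     (\<Sum>e\<in>incident_edges E v. vector_derivative (local_comp f v e) (at 0 within {0..1})) = 0"

definition laplacian_dom :: "'v pair_pre_digraph \<Rightarrow> ('v \<times> 'v) set \<Rightarrow> 'v qg_fun set" where
  "laplacian_dom G E =
     {f. (\<forall>e\<in>E. f e \<in> H2_unit) \<and>
         (\<forall>v\<in>pverts G. continuous_at_vertex E f v \<and> kirchhoff_at_vertex E f v)}"

definition laplacian :: "'v qg_fun \<Rightarrow> 'v qg_fun" where
  "laplacian f = (\<lambda>e x. - L2_deriv2 (f e) x)"

definition laplacian_eigenfunction ::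
    "'v pair_pre_digraph \<Rightarrow> ('v \<times> 'v) set \<Rightarrow> complex \<Rightarrow> 'v qg_fun \<Rightarrow> bool" where
  "laplacian_eigenfunction G E c f \<longleftrightarrow>
     f \<in> laplacian_dom G E \<and> \<not> qg_ae_eq E f (\<lambda>e x. 0) \<and>
     qg_ae_eq E (laplacian f) (\<lambda>e x. c * f e x)"

definition trig_comb :: "real \<Rightarrow> complex \<times> complex \<Rightarrow> real \<Rightarrow> complex" where
  "trig_comb \<omega> p x = fst p * complex_of_real (cos (\<omega> * x)) + snd p * complex_of_real (sin (\<omega> * x))"

text \<open>The pair \<open>(A, B)\<close> is unique for \<open>\<omega> > 0\<close>, and exists for components of eigenfunctions.\<close>

definition trig_coeffs :: "real \<Rightarrow> (real \<Rightarrow> complex) \<Rightarrow> complex \<times> complex" where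
  "trig_coeffs \<omega> u = (THE p. \<forall>x\<in>{0..1}. u x = trig_comb \<omega> p x)"

definition freq_shift :: "real \<Rightarrow> nat \<Rightarrow> 'v qg_fun \<Rightarrow> 'v qg_fun" where
  "freq_shift \<omega> m y = (\<lambda>e. trig_comb (\<omega> + 2 * real m * pi) (trig_coeffs \<omega> (y e)))"

end

theory Submission
  imports Defs
begin

text \<open>
  Let \<open>f = A cos \<omega>x + B sin \<omega>x\<close> and \<open>g = C cos \<omega>x + D sin \<omega>x\<close> on an edge.  The energy density
  \<open>f' g'* + \<omega>\<^sup>2 f g*\<close> is the constant \<open>\<omega>\<^sup>2 (A C* + B D*)\<close>, so
  \<open>(f g'*)' = \<omega>\<^sup>2 (A C* + B D*) - 2 \<omega>\<^sup>2 f g*\<close>.  After integration over all edges the boundary terms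
  regroup at the vertices, where they cancel because \<open>f\<close> is continuous and \<open>g\<close> satisfies the
  Kirchhoff condition.  Hence the inner product is half the sum of \<open>A C* + B D*\<close> over the edges,
  which depends on the amplitudes but not on the frequency.
\<close>

section \<open>Sobolev functions on the unit interval\<close>

lemma L2_unit_integrable:
  assumes "v \<in> L2_unit"
  shows "integrable (lebesgue_on {0..1}) v"
proof -
  interpret finite_measure "lebesgue_on {0..1::real}"
    by (intro finite_measure_lebesgue_on) simp
  have meas: "v \<in> borel_measurable (lebesgue_on {0..1})"
    and square: "integrable (lebesgue_on {0..1}) (\<lambda>x. (cmod (v x))\<^sup>2)"
    using assms by (auto simp: L2_unit_def)
  have "integrable (lebesgue_on {0..1}) (\<lambda>x. cmod (v x))"
    by (rule square_integrable_imp_integrable) (use meas square in auto)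
  with meas show ?thesis
    by (simp add: integrable_norm_iff)
qed

lemma has_L2_deriv_has_integral:
  assumes "has_L2_deriv u v" "x \<in> {0..1}"
  shows "(v has_integral (u x - u 0)) {0..x}"
proof -
  have "integrable (lebesgue_on {0..1}) v"
    using assms(1) by (simp add: has_L2_deriv_def L2_unit_integrable)
  then have "integrable (lebesgue_on {0..x}) v"
    by (rule integrable_subinterval) (use assms(2) in auto)
  then have "(v has_integral (LINT t|lebesgue_on {0..x}. v t)) {0..x}"
    by (rule has_integral_integral_lebesgue_on) simp
  moreover have "u x = u 0 + (LINT t|lebesgue_on {0..x}. v t)"
    using assms unfolding has_L2_deriv_def by blast
  ultimately show ?thesis
    by simp
qed

lemma has_L2_deriv_continuous_on:
  assumes "has_L2_deriv u v"
  shows "continuous_on {0..1} u"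
proof -
  have "v integrable_on {0..1}"
    using has_L2_deriv_has_integral[OF assms, of 1] by auto
  then have "continuous_on {0..1} (\<lambda>x. u 0 + integral {0..x} v)"
    by (intro continuous_intros indefinite_integral_continuous_1)
  then show ?thesis
    by (rule continuous_on_eq) (simp add: integral_unique[OF has_L2_deriv_has_integral[OF assms]])
qed

lemma has_L2_deriv_has_vector_derivative:
  assumes "has_L2_deriv u v" "AE x in lebesgue_on {0..1}. v x = w x"
    and "continuous_on {0..1} w" "x \<in> {0..1}"
  shows "(u has_vector_derivative w x) (at x within {0..1})"
proof -
  have u_eq: "u t = u 0 + integral {0..t} w" if "t \<in> {0..1}" for t
  proof -
    have "AE x in lborel. x \<in> {0..1} \<longrightarrow> v x = w x"
      using assms(2) by (simp add: AE_restrict_space_iff AE_completion_iff)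
    then have "AE x in lborel. x \<in> {0..t} \<longrightarrow> v x = w x"
      using that by (auto elim!: eventually_mono)
    then have "(w has_integral (u t - u 0)) {0..t}"
      using has_L2_deriv_has_integral[OF assms(1) that] by (simp add: has_integral_AE)
    then show ?thesis
      by (simp add: integral_unique)
  qed
  have "((\<lambda>t. u 0 + integral {0..t} w) has_vector_derivative w x) (at x within {0..1})"
    using has_vector_derivative_add[OF has_vector_derivative_const
        integral_has_vector_derivative[OF assms(3,4)]] by simp
  with assms(4) u_eq show ?thesis
    by (rule has_vector_derivative_transform)
qed

section \<open>Eigenfunctions on an edge\<close>

lemma laplacian_eigenfunction_ode:
  assumes "laplacian_eigenfunction G E c y" "e \<in> E"
  obtains v where
    "\<And>x. x \<in> {0..1} \<Longrightarrow> (y e has_vector_derivative v x) (at x within {0..1})"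
    "\<And>x. x \<in> {0..1} \<Longrightarrow> (v has_vector_derivative - c * y e x) (at x within {0..1})"
proof -
  have "\<exists>w. has_L2_deriv2 (y e) w"
    using assms by (auto simp: laplacian_eigenfunction_def laplacian_dom_def H2_unit_def)
  then have "has_L2_deriv2 (y e) (L2_deriv2 (y e))"
    unfolding L2_deriv2_def by (rule someI_ex)
  then obtain v where v: "has_L2_deriv (y e) v" "has_L2_deriv v (L2_deriv2 (y e))"
    by (auto simp: has_L2_deriv2_def)
  have "AE x in lebesgue_on {0..1}. - L2_deriv2 (y e) x = c * y e x"
    using assms by (simp add: laplacian_eigenfunction_def qg_ae_eq_def laplacian_def)
  then have eigen: "AE x in lebesgue_on {0..1}. L2_deriv2 (y e) x = - c * y e x"
    by eventually_elim (metis minus_minus mult_minus_left)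
  have cont: "continuous_on {0..1} (\<lambda>x. - c * y e x)"
    by (intro continuous_intros has_L2_deriv_continuous_on[OF v(1)])
  show thesis
  proof (rule that)
    show "(y e has_vector_derivative v x) (at x within {0..1})" if "x \<in> {0..1}" for x
      by (rule has_L2_deriv_has_vector_derivative[OF v(1) _ has_L2_deriv_continuous_on[OF v(2)] that])
        simp
    show "(v has_vector_derivative - c * y e x) (at x within {0..1})" if "x \<in> {0..1}" for x
      by (rule has_L2_deriv_has_vector_derivative[OF v(2) eigen cont that])
  qed
qed

lemma harmonic_oscillator_invariant:
  fixes u v :: "real \<Rightarrow> 'a :: real_normed_vector"
  assumes "convex S" "0 \<in> S" "x \<in> S"
    and u: "\<And>t. t \<in> S \<Longrightarrow> (u has_vector_derivative \<omega> *\<^sub>R v t) (at t within S)"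
    and v: "\<And>t. t \<in> S \<Longrightarrow> (v has_vector_derivative - \<omega> *\<^sub>R u t) (at t within S)"
  shows "cos (\<omega> * x) *\<^sub>R u x - sin (\<omega> * x) *\<^sub>R v x = u 0"
proof -
  define P where "P t = cos (\<omega> * t) *\<^sub>R u t - sin (\<omega> * t) *\<^sub>R v t" for t
  have "(P has_vector_derivative 0) (at t within S)" if "t \<in> S" for t
    unfolding P_def[abs_def]
    by (auto intro!: derivative_eq_intros u[OF that] v[OF that] simp: algebra_simps)
  then obtain c where "\<And>t. t \<in> S \<Longrightarrow> P t = c"
    using has_vector_derivative_zero_constant[OF \<open>convex S\<close>] by blast
  then have "P x = P 0"
    using assms(2,3) by simp
  then show ?thesis
    by (simp add: P_def)
qed

lemma harmonic_oscillator_solution: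
  fixes u v :: "real \<Rightarrow> 'a :: real_normed_vector"
  assumes S: "convex S" "0 \<in> S" "x \<in> S"
    and u: "\<And>t. t \<in> S \<Longrightarrow> (u has_vector_derivative \<omega> *\<^sub>R v t) (at t within S)"
    and v: "\<And>t. t \<in> S \<Longrightarrow> (v has_vector_derivative - \<omega> *\<^sub>R u t) (at t within S)"
  shows "u x = cos (\<omega> * x) *\<^sub>R u 0 + sin (\<omega> * x) *\<^sub>R v 0"
proof -
  have u0: "cos (\<omega> * x) *\<^sub>R u x - sin (\<omega> * x) *\<^sub>R v x = u 0"
    using S u v by (rule harmonic_oscillator_invariant)
  have v0: "cos (\<omega> * x) *\<^sub>R v x - sin (\<omega> * x) *\<^sub>R - u x = v 0"
    using S by (rule harmonic_oscillator_invariant)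
      (use u v in \<open>auto intro!: derivative_eq_intros\<close>)
  have "u x = ((cos (\<omega> * x))\<^sup>2 + (sin (\<omega> * x))\<^sup>2) *\<^sub>R u x"
    by simp
  also have "\<dots> = (cos (\<omega> * x))\<^sup>2 *\<^sub>R u x + (sin (\<omega> * x))\<^sup>2 *\<^sub>R u x"
    by (rule scaleR_add_left)
  also have "\<dots> = cos (\<omega> * x) *\<^sub>R (cos (\<omega> * x) *\<^sub>R u x - sin (\<omega> * x) *\<^sub>R v x)
      + sin (\<omega> * x) *\<^sub>R (cos (\<omega> * x) *\<^sub>R v x - sin (\<omega> * x) *\<^sub>R - u x)"
    by (simp add: algebra_simps power2_eq_square)
  finally show ?thesis
    unfolding u0 v0 .
qed

lemma trig_comb_eq_scaleR:
  "trig_comb \<omega> p x = cos (\<omega> * x) *\<^sub>R fst p + sin (\<omega> * x) *\<^sub>R snd p"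
  by (simp add: trig_comb_def scaleR_conv_of_real mult.commute)

definition trig_deriv :: "real \<Rightarrow> complex \<times> complex \<Rightarrow> real \<Rightarrow> complex" where
  "trig_deriv \<omega> p = trig_comb \<omega> (\<omega> *\<^sub>R snd p, - \<omega> *\<^sub>R fst p)"

lemma has_vector_derivative_trig_comb [derivative_intros]:
  "(trig_comb \<omega> p has_vector_derivative trig_deriv \<omega> p x) (at x within S)"
  unfolding trig_deriv_def trig_comb_eq_scaleR[abs_def]
  by (auto intro!: derivative_eq_intros simp: algebra_simps)

lemma has_vector_derivative_trig_deriv [derivative_intros]:
  "(trig_deriv \<omega> p has_vector_derivative - \<omega>\<^sup>2 *\<^sub>R trig_comb \<omega> p x) (at x within S)"
proof -
  have "trig_deriv \<omega> (\<omega> *\<^sub>R snd p, - \<omega> *\<^sub>R fst p) x = - \<omega>\<^sup>2 *\<^sub>R trig_comb \<omega> p x"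
    by (simp add: trig_deriv_def trig_comb_eq_scaleR power2_eq_square algebra_simps)
  then show ?thesis
    using has_vector_derivative_trig_comb[of \<omega> "(\<omega> *\<^sub>R snd p, - \<omega> *\<^sub>R fst p)" x S]
    by (simp add: trig_deriv_def[of \<omega> p])
qed

lemma laplacian_eigenfunction_eq_trig_comb:
  assumes "laplacian_eigenfunction G E (complex_of_real (\<omega>\<^sup>2)) y" "\<omega> \<noteq> 0" "e \<in> E"
  obtains p where "\<And>x. x \<in> {0..1} \<Longrightarrow> y e x = trig_comb \<omega> p x"
proof -
  from assms(1,3) obtain v where
    v: "\<And>x. x \<in> {0..1} \<Longrightarrow> (y e has_vector_derivative v x) (at x within {0..1})"
      "\<And>x. x \<in> {0..1} \<Longrightarrow>
        (v has_vector_derivative - complex_of_real (\<omega>\<^sup>2) * y e x) (at x within {0..1})"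
    by (rule laplacian_eigenfunction_ode) blast
  define w where "w x = v x /\<^sub>R \<omega>" for x
  have "y e x = trig_comb \<omega> (y e 0, w 0) x" if "x \<in> {0..1}" for x
    unfolding trig_comb_eq_scaleR fst_conv snd_conv
  proof (rule harmonic_oscillator_solution[OF _ _ that])
    show "(y e has_vector_derivative \<omega> *\<^sub>R w t) (at t within {0..1})" if "t \<in> {0..1}" for t
      using v(1)[OF that] \<open>\<omega> \<noteq> 0\<close> by (simp add: w_def)
    show "(w has_vector_derivative - \<omega> *\<^sub>R y e t) (at t within {0..1})" if "t \<in> {0..1}" for t
      unfolding w_def[abs_def] using \<open>\<omega> \<noteq> 0\<close>
      by (auto intro!: derivative_eq_intros v(2)[OF that]
          simp: scaleR_conv_of_real power2_eq_square field_simps)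
  qed auto
  then show thesis
    by (rule that)
qed

lemma trig_comb_inject:
  assumes "\<omega> \<noteq> 0" "\<And>x. x \<in> {0..1} \<Longrightarrow> trig_comb \<omega> p x = trig_comb \<omega> q x"
  shows "p = q"
proof -
  have "(trig_comb \<omega> p has_vector_derivative trig_deriv \<omega> q 0) (at 0 within {0..1})"
    by (rule has_vector_derivative_transform[OF _ _ has_vector_derivative_trig_comb])
      (auto simp: assms(2))
  with has_vector_derivative_trig_comb have "trig_deriv \<omega> p 0 = trig_deriv \<omega> q 0"
    by (rule vector_derivative_unique_within[rotated]) (simp add: trivial_limit_within)
  moreover have "trig_comb \<omega> p 0 = trig_comb \<omega> q 0"
    by (rule assms(2)) simp
  ultimately show ?thesis
    using \<open>\<omega> \<noteq> 0\<close> by (simp add: trig_deriv_def trig_comb_eq_scaleR prod_eq_iff)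
qed

lemma trig_coeffs_eqI:
  assumes "\<omega> \<noteq> 0" and u: "\<And>x. x \<in> {0..1} \<Longrightarrow> u x = trig_comb \<omega> p x"
  shows "trig_coeffs \<omega> u = p"
  unfolding trig_coeffs_def
proof (rule the_equality)
  show "q = p" if "\<forall>x\<in>{0..1}. u x = trig_comb \<omega> q x" for q
    by (rule trig_comb_inject[OF \<open>\<omega> \<noteq> 0\<close>]) (use that u in auto)
qed (use u in blast)

lemma trig_comb_trig_coeffs:
  assumes "laplacian_eigenfunction G E (complex_of_real (\<omega>\<^sup>2)) y" "\<omega> \<noteq> 0" "e \<in> E" "x \<in> {0..1}"
  shows "trig_comb \<omega> (trig_coeffs \<omega> (y e)) x = y e x"
proof -
  obtain p where p: "\<And>x. x \<in> {0..1} \<Longrightarrow> y e x = trig_comb \<omega> p x"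
    using laplacian_eigenfunction_eq_trig_comb[OF assms(1-3)] by blast
  have "trig_coeffs \<omega> (y e) = p"
    using \<open>\<omega> \<noteq> 0\<close> p by (rule trig_coeffs_eqI)
  with p assms(4) show ?thesis
    by simp
qed

section \<open>Boundary terms\<close>

definition inward_deriv :: "'v qg_fun \<Rightarrow> 'v \<Rightarrow> 'v \<times> 'v \<Rightarrow> complex" where
  "inward_deriv f v e = vector_derivative (local_comp f v e) (at 0 within {0..1})"

lemma inward_deriv_fst:
  assumes "(f e has_vector_derivative d) (at 0 within {0..1})"
  shows "inward_deriv f (fst e) e = d"
  unfolding inward_deriv_def
  by (rule vector_derivative_within_closed_interval) (use assms in \<open>auto simp: local_comp_def\<close>)

lemma inward_deriv_snd:
  assumes "fst e \<noteq> snd e" "(f e has_vector_derivative d) (at 1 within {0..1})"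
  shows "inward_deriv f (snd e) e = - d"
proof -
  have reflect: "((\<lambda>x. 1 - x) has_vector_derivative - 1) (at (0::real) within {0..1})"
    by (auto intro!: derivative_eq_intros)
  have "(\<lambda>x. 1 - x) ` {0..1} = {0..1::real}"
    by (simp add: image_diff_atLeastAtMost)
  then have "((\<lambda>x. f e (1 - x)) has_vector_derivative - d) (at 0 within {0..1})"
    using vector_diff_chain_within[OF reflect, of "f e" d] assms(2) by (simp add: o_def)
  then have "vector_derivative (\<lambda>x. f e (1 - x)) (at 0 within {0..1}) = - d"
    by (rule vector_derivative_within_closed_interval[rotated 2]) auto
  then show ?thesis
    using assms(1) by (simp add: inward_deriv_def local_comp_def)
qed

lemma sum_vertices_incident_edges:
  fixes h :: "'v \<Rightarrow> 'v \<times> 'v \<Rightarrow> 'a :: comm_monoid_add"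
  assumes "finite V" "finite E" "E \<subseteq> V \<times> V" "\<And>e. e \<in> E \<Longrightarrow> fst e \<noteq> snd e"
  shows "(\<Sum>v\<in>V. \<Sum>e\<in>incident_edges E v. h v e) = (\<Sum>e\<in>E. h (fst e) e + h (snd e) e)"
proof -
  have "(\<Sum>v\<in>V. \<Sum>e\<in>incident_edges E v. h v e)
      = (\<Sum>e\<in>E. \<Sum>v | v \<in> V \<and> (v = fst e \<or> v = snd e). h v e)"
    unfolding incident_edges_def using assms(1,2) by (rule sum.swap_restrict)
  also have "\<dots> = (\<Sum>e\<in>E. \<Sum>v\<in>{fst e, snd e}. h v e)"
    using assms(3) by (intro sum.cong) auto
  also have "\<dots> = (\<Sum>e\<in>E. h (fst e) e + h (snd e) e)"
    using assms(4) by (intro sum.cong) auto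
  finally show ?thesis .
qed

lemma sum_vertex_flux_eq_0:
  assumes "continuous_at_vertex E f v" "kirchhoff_at_vertex E g v"
  shows "(\<Sum>e\<in>incident_edges E v. local_comp f v e 0 * cnj (inward_deriv g v e)) = 0"
proof (cases "incident_edges E v = {}")
  case False
  then obtain e\<^sub>0 where "e\<^sub>0 \<in> incident_edges E v"
    by blast
  then have "local_comp f v e 0 = local_comp f v e\<^sub>0 0" if "e \<in> incident_edges E v" for e
    using assms(1) that unfolding continuous_at_vertex_def by blast
  then have "(\<Sum>e\<in>incident_edges E v. local_comp f v e 0 * cnj (inward_deriv g v e))
      = local_comp f v e\<^sub>0 0 * cnj (\<Sum>e\<in>incident_edges E v. inward_deriv g v e)"
    by (simp add: sum_distrib_left)
  also have "\<dots> = 0"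
    using assms(2) by (simp add: kirchhoff_at_vertex_def inward_deriv_def)
  finally show ?thesis .
qed simp

lemma (in pair_digraph) sum_boundary_terms_eq_0:
  assumes "E \<subseteq> parcs G" and f: "f \<in> laplacian_dom G E" and g: "g \<in> laplacian_dom G E"
    and deriv: "\<And>e x. e \<in> E \<Longrightarrow> x \<in> {0..1} \<Longrightarrow>
      (g e has_vector_derivative g' e x) (at x within {0..1})"
  shows "(\<Sum>e\<in>E. f e 1 * cnj (g' e 1) - f e 0 * cnj (g' e 0)) = 0"
proof -
  have loopfree: "fst e \<noteq> snd e" if "e \<in> E" for e
    using that assms(1) pair_no_loops by blast
  have "E \<subseteq> pverts G \<times> pverts G"
    using assms(1) by (auto dest: in_arcsD1 in_arcsD2)
  moreover have "finite E"
    using assms(1) pair_finite_arcs by (rule finite_subset)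
  ultimately have "(\<Sum>v\<in>pverts G. \<Sum>e\<in>incident_edges E v.
      local_comp f v e 0 * cnj (inward_deriv g v e))
      = (\<Sum>e\<in>E. local_comp f (fst e) e 0 * cnj (inward_deriv g (fst e) e)
          + local_comp f (snd e) e 0 * cnj (inward_deriv g (snd e) e))"
    using loopfree pair_finite_verts by (intro sum_vertices_incident_edges)
  also have "\<dots> = (\<Sum>e\<in>E. f e 0 * cnj (g' e 0) - f e 1 * cnj (g' e 1))"
  proof (rule sum.cong[OF refl])
    fix e assume "e \<in> E"
    then have "inward_deriv g (fst e) e = g' e 0" "inward_deriv g (snd e) e = - g' e 1"
      by (intro inward_deriv_fst inward_deriv_snd loopfree deriv; simp)+
    then show "local_comp f (fst e) e 0 * cnj (inward_deriv g (fst e) e)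
        + local_comp f (snd e) e 0 * cnj (inward_deriv g (snd e) e)
        = f e 0 * cnj (g' e 0) - f e 1 * cnj (g' e 1)"
      using loopfree[OF \<open>e \<in> E\<close>] by (simp add: local_comp_def)
  qed
  also have "\<dots> = - (\<Sum>e\<in>E. f e 1 * cnj (g' e 1) - f e 0 * cnj (g' e 0))"
    by (simp flip: sum_negf)
  finally show ?thesis
    using f g by (simp add: laplacian_dom_def sum_vertex_flux_eq_0)
qed

section \<open>Inner products\<close>

definition amplitude_inner :: "complex \<times> complex \<Rightarrow> complex \<times> complex \<Rightarrow> complex" where
  "amplitude_inner p q = fst p * cnj (fst q) + snd p * cnj (snd q)"

lemma trig_energy_density:
  "trig_deriv \<omega> p x * cnj (trig_deriv \<omega> q x)
      + \<omega>\<^sup>2 *\<^sub>R (trig_comb \<omega> p x * cnj (trig_comb \<omega> q x))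
    = \<omega>\<^sup>2 *\<^sub>R amplitude_inner p q"
proof -
  define c s where "c = complex_of_real (cos (\<omega> * x))" and "s = complex_of_real (sin (\<omega> * x))"
  have trig: "trig_comb \<omega> r x = fst r * c + snd r * s" for r
    by (simp add: trig_comb_def c_def s_def)
  have real: "cnj c = c" "cnj s = s"
    by (simp_all add: c_def s_def)
  have pythagoras: "c * c + s * s = 1"
    by (simp add: c_def s_def flip: of_real_mult of_real_add)
  have "trig_deriv \<omega> p x * cnj (trig_deriv \<omega> q x)
      + \<omega>\<^sup>2 *\<^sub>R (trig_comb \<omega> p x * cnj (trig_comb \<omega> q x))
      = \<omega>\<^sup>2 *\<^sub>R ((c * c + s * s) * amplitude_inner p q)"
    by (simp add: trig_deriv_def trig real amplitude_inner_def scaleR_conv_of_real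
        power2_eq_square algebra_simps)
  then show ?thesis
    by (simp add: pythagoras)
qed

lemma integral_trig_comb_mult_cnj:
  assumes "\<omega> \<noteq> 0"
  shows "(LINT x|lebesgue_on {0..1}. trig_comb \<omega> p x * cnj (trig_comb \<omega> q x))
    = amplitude_inner p q / 2
      - (trig_comb \<omega> p 1 * cnj (trig_deriv \<omega> q 1) - trig_comb \<omega> p 0 * cnj (trig_deriv \<omega> q 0))
        / (2 * \<omega>\<^sup>2)"
proof -
  let ?prod = "\<lambda>x. trig_comb \<omega> p x * cnj (trig_comb \<omega> q x)"
  let ?flux = "\<lambda>x. trig_comb \<omega> p x * cnj (trig_deriv \<omega> q x)"
  let ?int = "LINT x|lebesgue_on {0..1}. ?prod x"
  let ?flux' = "\<lambda>x. \<omega>\<^sup>2 *\<^sub>R amplitude_inner p q - (2 * \<omega>\<^sup>2) *\<^sub>R ?prod x"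
  have "(?flux has_vector_derivative ?flux' x) (at x within {0..1})" for x
    unfolding trig_energy_density[of \<omega> p x q, symmetric]
    by (auto intro!: derivative_eq_intros simp: scaleR_conv_of_real algebra_simps)
  then have "(?flux' has_integral (?flux 1 - ?flux 0)) {0..1}"
    by (intro fundamental_theorem_of_calculus) auto
  moreover have "(?flux' has_integral (\<omega>\<^sup>2 *\<^sub>R amplitude_inner p q - (2 * \<omega>\<^sup>2) *\<^sub>R ?int)) {0..1}"
  proof -
    have "integrable (lebesgue_on {0..1}) ?prod"
      unfolding trig_comb_def by (intro continuous_imp_integrable_real continuous_intros)
    then have "(?prod has_integral ?int) {0..1}"
      by (rule has_integral_integral_lebesgue_on) simp
    then show ?thesis
      using has_integral_const_real[of "\<omega>\<^sup>2 *\<^sub>R amplitude_inner p q" 0 1]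
      by (intro has_integral_diff[OF _ has_integral_cmul]) simp_all
  qed
  ultimately have "?flux 1 - ?flux 0 = \<omega>\<^sup>2 *\<^sub>R amplitude_inner p q - (2 * \<omega>\<^sup>2) *\<^sub>R ?int"
    by (rule has_integral_unique)
  then show ?thesis
    using assms by (simp add: scaleR_conv_of_real diff_divide_distrib)
qed

lemma (in pair_digraph) qg_inner_eq_sum_amplitude_inner:
  assumes "E \<subseteq> parcs G" "\<omega> \<noteq> 0" and dom: "f \<in> laplacian_dom G E" "g \<in> laplacian_dom G E"
    and f: "\<And>e x. e \<in> E \<Longrightarrow> x \<in> {0..1} \<Longrightarrow> f e x = trig_comb \<omega> (p e) x"
    and g: "\<And>e x. e \<in> E \<Longrightarrow> x \<in> {0..1} \<Longrightarrow> g e x = trig_comb \<omega> (q e) x"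
  shows "qg_inner E f g = (\<Sum>e\<in>E. amplitude_inner (p e) (q e)) / 2"
proof -
  let ?g' = "\<lambda>e. trig_deriv \<omega> (q e)"
  have "(g e has_vector_derivative ?g' e x) (at x within {0..1})" if "e \<in> E" "x \<in> {0..1}" for e x
    using that g
    by (intro has_vector_derivative_transform[OF _ _ has_vector_derivative_trig_comb]) auto
  then have boundary: "(\<Sum>e\<in>E. f e 1 * cnj (?g' e 1) - f e 0 * cnj (?g' e 0)) = 0"
    using assms(1) dom by (intro sum_boundary_terms_eq_0)
  have "qg_inner E f g
      = (\<Sum>e\<in>E. LINT x|lebesgue_on {0..1}. trig_comb \<omega> (p e) x * cnj (trig_comb \<omega> (q e) x))"
    unfolding qg_inner_def
    by (intro sum.cong Bochner_Integration.integral_cong) (auto simp: f g)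
  also have "\<dots> = (\<Sum>e\<in>E. amplitude_inner (p e) (q e) / 2
      - (f e 1 * cnj (?g' e 1) - f e 0 * cnj (?g' e 0)) / (2 * \<omega>\<^sup>2))"
    by (intro sum.cong) (simp_all add: integral_trig_comb_mult_cnj[OF \<open>\<omega> \<noteq> 0\<close>] f)
  also have "\<dots> = (\<Sum>e\<in>E. amplitude_inner (p e) (q e)) / 2"
    using boundary by (simp add: sum_subtractf flip: sum_divide_distrib)
  finally show ?thesis .
qed

lemma (in pair_digraph) qg_inner_freq_shift:
  assumes E: "E \<subseteq> parcs G" and "\<omega> > 0"
    and f: "laplacian_eigenfunction G E (complex_of_real (\<omega>\<^sup>2)) f"
    and g: "laplacian_eigenfunction G E (complex_of_real (\<omega>\<^sup>2)) g"
    and f': "f' \<in> laplacian_dom G E" "qg_eq E f' (freq_shift \<omega> m f)"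
    and g': "g' \<in> laplacian_dom G E" "qg_eq E g' (freq_shift \<omega> m g)"
  shows "qg_inner E f' g' = qg_inner E f g"
proof -
  let ?S = "(\<Sum>e\<in>E. amplitude_inner (trig_coeffs \<omega> (f e)) (trig_coeffs \<omega> (g e))) / 2"
  have "\<omega> + 2 * real m * pi > 0"
    using \<open>\<omega> > 0\<close> by (simp add: add_pos_nonneg)
  then have "qg_inner E f' g' = ?S"
    using f' g'
    by (intro qg_inner_eq_sum_amplitude_inner[OF E, where \<omega> = "\<omega> + 2 * real m * pi"])
      (auto simp: qg_eq_def freq_shift_def)
  moreover have "qg_inner E f g = ?S"
    using \<open>\<omega> > 0\<close> f g
    by (intro qg_inner_eq_sum_amplitude_inner[OF E, where \<omega> = \<omega>])
      (auto simp: laplacian_eigenfunction_def trig_comb_trig_coeffs[OF f] trig_comb_trig_coeffs[OF g])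
  ultimately show ?thesis
    by (simp only:)
qed

theorem corollary4p5:
  fixes G :: "'v pair_pre_digraph" and E :: "('v \<times> 'v) set"
    and \<omega> :: real and m :: nat and y\<^sub>1 y\<^sub>2 z\<^sub>1 z\<^sub>2 :: "'v qg_fun"
  assumes "pair_graph G"
    and "Digraph_Component.connected (with_proj G)"
    and "\<forall>v\<in>pverts G. out_degree (with_proj G) v \<ge> 2"
    and "orientation_of G E"
    and "\<omega> > 0"
    and "laplacian_eigenfunction G E (complex_of_real (\<omega>\<^sup>2)) y\<^sub>1"
    and "laplacian_eigenfunction G E (complex_of_real (\<omega>\<^sup>2)) y\<^sub>2"
    and "laplacian_eigenfunction G E (complex_of_real ((\<omega> + 2 * real m * pi)\<^sup>2)) z\<^sub>1"
    and "laplacian_eigenfunction G E (complex_of_real ((\<omega> + 2 * real m * pi)\<^sup>2)) z\<^sub>2"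
    and "qg_eq E z\<^sub>1 (freq_shift \<omega> m y\<^sub>1)"
    and "qg_eq E z\<^sub>2 (freq_shift \<omega> m y\<^sub>2)"
    and "qg_orthonormal E y\<^sub>1 y\<^sub>2"
  shows "qg_orthonormal E z\<^sub>1 z\<^sub>2"
proof -
  interpret pair_graph G
    by fact
  have E: "E \<subseteq> parcs G"
    using \<open>orientation_of G E\<close> by (simp add: orientation_of_def)
  have dom: "z\<^sub>1 \<in> laplacian_dom G E" "z\<^sub>2 \<in> laplacian_dom G E"
    using assms(8,9) by (simp_all add: laplacian_eigenfunction_def)
  note inner = qg_inner_freq_shift[OF E \<open>\<omega> > 0\<close>]
  have "qg_inner E z\<^sub>1 z\<^sub>1 = qg_inner E y\<^sub>1 y\<^sub>1" "qg_inner E z\<^sub>2 z\<^sub>2 = qg_inner E y\<^sub>2 y\<^sub>2"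
    "qg_inner E z\<^sub>1 z\<^sub>2 = qg_inner E y\<^sub>1 y\<^sub>2"
    using assms(6,7,10,11) dom by (auto intro: inner)
  then show ?thesis
    using assms(12) by (simp add: qg_orthonormal_def)
qed

end
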